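(* Let $A\in M_n(\mathbb R)$ be a generic matrix. Then the number of aligned values of $A$, counted with multiplicity, is odd.
   Context: $M_n(\mathbb R)$ is the space of real $n\times n$ matrices. $\mathcal S_n$ is the set of sign matrices, i.e. diagonal $n\times n$ matrices with all diagonal entries in $\{-1,+1\}$. An aligned trio of $A$ is a triple $(\lambda,S,v)$ with $\lambda\ge 0$ real, $S\in\mathcal S_n$, $v\in\mathbb R^n_{\ge 0}$, $\|v\|_2=1$, and $SAv=\lambda v$. Then $\lambda$ is called an aligned value of $A$. $A$ is generic if for every aligned trio $(\lambda,S,v)$ of $A$, $\lambda$ is a simple eigenvalue of $SA$ and $v$ is strictly positive (all entries $>0$). For generic $A$, the multiplicity of an aligned value $\lambda$ is the number of pairs $(S,v)$ such that $(\lambda,S,v)$ is an aligned trio of $A$.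
   Formalization: The 1×1 zero matrix is excluded: it is generic, but its only aligned value 0 has multiplicity 2 (from S = 1 and S = −1), so the count is even and the claim fails there; all other generic matrices are covered. *)

theory Defs
  imports "HOL-Analysis.Analysis" "HOL-Computational_Algebra.Polynomial"
begin

definition sign_matrices :: "(real^'n^'n) set" where
  "sign_matrices =
     {S. (\<forall>i. S $ i $ i \<in> {-1, 1}) \<and> (\<forall>i j. i \<noteq> j \<longrightarrow> S $ i $ j = 0)}"

definition charpoly :: "'a::comm_ring_1^'n^'n \<Rightarrow> 'a poly" where
  "charpoly M = det (\<chi> i j. (if i = j then [:0, 1:] else 0) - [:M $ i $ j:])"

(* Simple means algebraic multiplicity one. The characteristic polynomial is monic, so an
   order of 1 already makes c a root. *)
definition simple_eigenvalue :: "real^'n^'n \<Rightarrow> real \<Rightarrow> bool" where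
  "simple_eigenvalue M c \<longleftrightarrow> order c (charpoly M) = 1"

definition aligned_trio :: "real^'n^'n \<Rightarrow> real \<Rightarrow> real^'n^'n \<Rightarrow> real^'n \<Rightarrow> bool" where
  "aligned_trio A c S v \<longleftrightarrow>
     c \<ge> 0 \<and> S \<in> sign_matrices \<and> (\<forall>i. v $ i \<ge> 0) \<and> norm v = 1 \<and>
     (S ** A) *v v = c *\<^sub>R v"

definition aligned_values :: "real^'n^'n \<Rightarrow> real set" where
  "aligned_values A = {c. \<exists>S v. aligned_trio A c S v}"

definition generic_matrix :: "real^'n^'n \<Rightarrow> bool" where
  "generic_matrix A \<longleftrightarrow>
     (\<forall>c S v. aligned_trio A c S v \<longrightarrow> simple_eigenvalue (S ** A) c \<and> (\<forall>i. v $ i > 0))"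

(* For generic A the set of pairs is finite, so card loses nothing. *)
definition aligned_multiplicity :: "real^'n^'n \<Rightarrow> real \<Rightarrow> nat" where
  "aligned_multiplicity A c = card {(S, v). aligned_trio A c S v}"

(* The 1 x 1 zero matrix is generic, but its only aligned value 0 comes from the two pairs
   (1, 1) and (-1, 1). Hence it violates the parity statement and has to be excluded there. *)
lemma zero_1x1_counterexample:
  defines "A \<equiv> (0 :: real^1^1)"
  shows "generic_matrix A" and "even (\<Sum>c\<in>aligned_values A. aligned_multiplicity A c)"
proof -
  have nv: "norm v = 1 \<and> (\<forall>i. v $ i \<ge> 0) \<longleftrightarrow> v = vec 1" for v :: "real^1"
    by (auto simp: vec_eq_iff norm_real)
  have S: "S \<in> sign_matrices \<longleftrightarrow> S = mat 1 \<or> S = mat (-1)" for S :: "real^1^1"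
    by (auto simp: sign_matrices_def vec_eq_iff mat_def)
  have trio: "aligned_trio A c S v \<longleftrightarrow> c = 0 \<and> S \<in> {mat 1, mat (-1)} \<and> v = vec 1" for c S v
    using nv[of v] S[of S] by (auto simp: aligned_trio_def A_def)
  have "order 0 [:0, 1 :: real:] = 1"
    using order_power_n_n[of "0::real" 1] by simp
  then have "simple_eigenvalue A 0"
    by (simp add: simple_eigenvalue_def charpoly_def A_def det_1)
  moreover have "S ** A = A" for S
    by (simp add: A_def)
  ultimately show "generic_matrix A"
    by (auto simp: generic_matrix_def trio)
  have "mat 1 \<noteq> (mat (-1) :: real^1^1)"
    by (simp add: mat_def vec_eq_iff)
  moreover have "{(S, v). aligned_trio A 0 S v} = {(mat 1, vec 1), (mat (-1), vec 1)}"
    by (auto simp: trio)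
  moreover have "aligned_values A = {0}"
    by (auto simp: aligned_values_def trio)
  ultimately show "even (\<Sum>c\<in>aligned_values A. aligned_multiplicity A c)"
    by (simp add: aligned_multiplicity_def)
qed

end

theory Submission
  imports Defs
begin

text \<open>For \<open>S\<close> a sign matrix, \<open>(c, S, v)\<close> is an aligned trio iff \<open>v\<close> is a nonnegative unit vector in the
  kernel of \<open>x S - A\<close> at \<open>x = c \<ge> 0\<close>. Fix a generic vector \<open>y\<close> and count, for each \<open>x > 0\<close>, the sign
  matrices \<open>S\<close> such that \<open>(x S - A) v = y\<close> has a strictly positive solution; equivalently, the
  preimages of \<open>y\<close> under the piecewise linear map sending \<open>w\<close> to \<open>x w - A \<bar>w\<bar>\<close>, where \<open>w = S v\<close>. Modulo 2 this
  is the degree of the map. A solution that crosses a coordinate hyperplane continues in, or annihilates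
  with, the solution for the neighbouring sign matrix, so the parity can only change where a positive
  solution escapes to infinity. By genericity of \<open>A\<close> that happens exactly at the positive aligned
  values, once for each trio. For large \<open>x\<close> the count is 1, near 0 it is even, and the value 0
  contributes an even number of trios, because a nonnegative kernel vector of \<open>A\<close> is aligned for
  every \<open>S\<close>.\<close>

section \<open>Sign matrices\<close>

lemma sign_matrix_diag: "S \<in> sign_matrices \<Longrightarrow> S $ i $ i = 1 \<or> S $ i $ i = -1"
  by (auto simp: sign_matrices_def)

lemma sign_matrix_vector_component:
  assumes "S \<in> sign_matrices"
  shows "(S *v v) $ i = S $ i $ i * v $ i"
proof -
  have "(S *v v) $ i = (\<Sum>j\<in>UNIV. if j = i then S $ i $ i * v $ i else 0)"
    unfolding matrix_vector_mult_def vec_lambda_beta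
    by (rule sum.cong) (use assms in \<open>auto simp: sign_matrices_def\<close>)
  then show ?thesis
    by simp
qed

lemma sign_matrix_square:
  assumes "S \<in> sign_matrices"
  shows "S ** S = mat 1"
proof -
  have "S $ i $ i * (S $ i $ i * v) = v" for i v
    using sign_matrix_diag[OF assms, of i] by auto
  then show ?thesis
    by (simp add: matrix_eq vec_eq_iff matrix_vector_mul_assoc[symmetric]
        sign_matrix_vector_component[OF assms])
qed

lemma norm_sign_matrix_mult:
  assumes "S \<in> sign_matrices"
  shows "norm (S *v v) = norm v"
proof -
  have "\<bar>S $ i $ i * v $ i\<bar> = \<bar>v $ i\<bar>" for i
    using sign_matrix_diag[OF assms, of i] by auto
  then show ?thesis
    by (simp add: norm_vec_def sign_matrix_vector_component[OF assms])
qed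

lemma sign_matrix_eqI:
  assumes "S \<in> sign_matrices" "T \<in> sign_matrices" "\<And>i. S $ i $ i = T $ i $ i"
  shows "S = T"
proof -
  have "S $ i $ j = T $ i $ j" for i j
    using assms by (cases "i = j") (auto simp: sign_matrices_def)
  then show ?thesis
    by (simp add: vec_eq_iff)
qed

lemma finite_sign_matrices: "finite (sign_matrices :: (real^'n^'n) set)"
proof (rule finite_imageD)
  show "inj_on (\<lambda>S i. S $ i $ i) (sign_matrices :: (real^'n^'n) set)"
    by (rule inj_onI, rule sign_matrix_eqI) (auto dest: fun_cong)
  have "(\<lambda>S i. S $ i $ i) ` (sign_matrices :: (real^'n^'n) set) \<subseteq> (UNIV :: 'n set) \<rightarrow>\<^sub>E {-1, 1}"
    by (auto simp: sign_matrices_def)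
  then show "finite ((\<lambda>S i. S $ i $ i) ` (sign_matrices :: (real^'n^'n) set))"
    by (rule finite_subset) (auto intro: finite_PiE)
qed

lemma diag_in_sign_matrices:
  "(\<And>i. s i \<in> {-1, 1}) \<Longrightarrow> (\<chi> i j. if i = j then s i else 0) \<in> sign_matrices"
  by (auto simp: sign_matrices_def)

text \<open>With \<open>w = S v\<close>, the matrices \<open>S\<close> and \<open>flip k S\<close>
  describe the two orthants that meet along the wall where coordinate \<open>k\<close> of
  \<open>w\<close> vanishes.\<close>

definition flip :: "'n \<Rightarrow> real^'n^'n \<Rightarrow> real^'n^'n" where
  "flip k S = (\<chi> i j. if i = k \<and> j = k then - S $ i $ j else S $ i $ j)"

lemma flip_in_sign_matrices [simp]: "S \<in> sign_matrices \<Longrightarrow> flip k S \<in> sign_matrices"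
  by (auto simp: sign_matrices_def flip_def)

lemma flip_flip [simp]: "flip k (flip k S) = S"
  by (simp add: flip_def vec_eq_iff)

lemma flip_component: "flip k S $ i $ j = (if i = k \<and> j = k then - S $ i $ j else S $ i $ j)"
  by (simp add: flip_def)

lemma uminus_in_sign_matrices [simp]: "S \<in> sign_matrices \<Longrightarrow> - S \<in> sign_matrices"
  by (auto simp: sign_matrices_def)

lemma sum_involution:
  fixes h :: "'a \<Rightarrow> nat"
  assumes "finite B"
    and "\<And>x. x \<in> B \<Longrightarrow> g x \<in> B \<and> g (g x) = x \<and> (P (g x) \<longleftrightarrow> \<not> P x)"
  shows "sum h B = (\<Sum>x\<in>{x \<in> B. P x}. h x + h (g x))"
proof -
  have "sum h B = sum h {x \<in> B. P x} + sum h {x \<in> B. \<not> P x}"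
    using assms(1) by (subst sum.union_disjoint[symmetric]) (auto intro: sum.cong)
  also have "sum h {x \<in> B. \<not> P x} = (\<Sum>x\<in>{x \<in> B. P x}. h (g x))"
    by (rule sum.reindex_bij_witness[of _ g g]) (use assms(2) in auto)
  finally show ?thesis
    by (simp add: sum.distrib)
qed

lemma even_card_involution:
  assumes "finite B"
    and "\<And>x. x \<in> B \<Longrightarrow> g x \<in> B \<and> g (g x) = x \<and> (P (g x) \<longleftrightarrow> \<not> P x)"
  shows "even (card B)"
proof -
  have "card B = (\<Sum>x\<in>{x \<in> B. P x}. 2)"
    using sum_involution[OF assms, where h = "\<lambda>_. 1"] by simp
  then show ?thesis
    by simp
qed

lemma flip_diag_sign:
  "S \<in> sign_matrices \<Longrightarrow> flip k S $ k $ k = 1 \<longleftrightarrow> S $ k $ k \<noteq> 1"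
  using sign_matrix_diag[of S k] by (auto simp: flip_component)

lemma even_card_sign_matrices: "even (card (sign_matrices :: (real^'n^'n) set))"
  \<comment> \<open>\<open>undefined\<close> is just some index; flipping any fixed diagonal entry
    pairs off the sign matrices.\<close>
  by (rule even_card_involution[where g = "flip undefined" and
        P = "\<lambda>S. S $ undefined $ undefined = 1"])
     (auto simp: finite_sign_matrices flip_diag_sign)

text \<open>A second index \<open>j\<close> provides a flip that leaves entry \<open>k\<close>
  alone. In dimension one this half is a single matrix.\<close>

lemma even_card_half_sign_matrices:
  assumes "CARD('n) \<noteq> 1"
  shows "even (card {S \<in> (sign_matrices :: (real^'n^'n) set). S $ k $ k = 1})"
proof -
  obtain j where "j \<noteq> k"
    using assms card_1_singleton_iff[of "UNIV :: 'n set"] by auto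
  then show ?thesis
    by (intro even_card_involution[where g = "flip j" and P = "\<lambda>S. S $ j $ j = 1"])
       (use sign_matrix_diag in \<open>auto simp: finite_sign_matrices flip_component\<close>)
qed

section \<open>The pencil of a sign matrix\<close>

text \<open>Equal to \<open>S (x I - S A)\<close> for a sign matrix, which is its own inverse. In
  this form \<open>S\<close> occurs only as a multiple of \<open>x\<close>, so it disappears at
  \<open>x = 0\<close>, and a flip affects only one entry.\<close>

definition pencil :: "real^'n^'n \<Rightarrow> real^'n^'n \<Rightarrow> real \<Rightarrow> real^'n^'n" where
  "pencil A S x = x *\<^sub>R S - A"

lemma pencil_mult: "pencil A S x *v v = x *\<^sub>R (S *v v) - A *v v"
  by (simp add: pencil_def matrix_vector_mult_diff_rdistrib scaleR_matrix_vector_assoc)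

lemma aligned_trio_iff:
  "aligned_trio A c S v \<longleftrightarrow> c \<ge> 0 \<and> S \<in> sign_matrices \<and> (\<forall>i. v $ i \<ge> 0) \<and> norm v = 1 \<and>
     pencil A S c *v v = 0"
proof -
  have "(S ** A) *v v = c *\<^sub>R v \<longleftrightarrow> pencil A S c *v v = 0" if S: "S \<in> sign_matrices"
  proof -
    have SS: "S *v (S *v w) = w" for w
      using sign_matrix_square[OF S] by (simp add: matrix_vector_mul_assoc)
    have "(S ** A) *v v = c *\<^sub>R v \<longleftrightarrow> S *v (A *v v) = S *v (c *\<^sub>R (S *v v))"
      by (simp add: matrix_vector_mul_assoc[symmetric] matrix_scaleR_vector_ac SS
          scaleR_matrix_vector_assoc[symmetric])
    also have "\<dots> \<longleftrightarrow> A *v v = c *\<^sub>R (S *v v)"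
      by (metis SS)
    finally show ?thesis
      by (auto simp: pencil_mult)
  qed
  then show ?thesis
    by (auto simp: aligned_trio_def)
qed

lemma poly_det: "poly (det P) x = det (\<chi> i j. poly (P $ i $ j) x)"
  for P :: "'a::comm_ring_1 poly^'n^'n"
  by (simp add: det_def poly_sum poly_prod)

lemma poly_charpoly:
  assumes "S \<in> sign_matrices"
  shows "poly (charpoly (S ** A)) x = det S * det (pencil A S x)"
proof -
  have "(\<chi> i j. poly ((if i = j then [:0, 1:] else 0) - [:(S ** A) $ i $ j:]) x) = x *\<^sub>R mat 1 - S ** A"
    by (simp add: vec_eq_iff mat_def)
  also have "\<dots> = S ** pencil A S x"
    unfolding pencil_def
    by (simp add: matrix_eq matrix_vector_mul_assoc[symmetric] matrix_vector_mult_diff_rdistrib 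
       matrix_vector_mult_diff_distrib scaleR_matrix_vector_assoc[symmetric] matrix_scaleR_vector_ac)
       (simp add: matrix_vector_mul_assoc sign_matrix_square[OF assms])
  finally show ?thesis
    by (simp add: charpoly_def poly_det det_mul)
qed

lemma det_sign_matrix_nonzero: "S \<in> sign_matrices \<Longrightarrow> det S \<noteq> 0"
  for S :: "real^'n^'n"
  using det_mul[of S S] sign_matrix_square[of S] by auto

lemma det_zero_iff_kernel: "det M = 0 \<longleftrightarrow> (\<exists>v. v \<noteq> 0 \<and> M *v v = 0)"
  for M :: "real^'n^'n"
proof -
  have "det M \<noteq> 0 \<longleftrightarrow> (\<forall>v. M *v v = 0 \<longrightarrow> v = 0)"
    by (metis invertible_det_nz invertible_left_inverse matrix_left_invertible_ker)
  then show ?thesis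
    by blast
qed

text \<open>Sign matrices are isometries, so a nonzero kernel vector keeps \<open>x\<close> below a
  norm bound for \<open>A\<close>, uniformly in \<open>S\<close>.\<close>

lemma det_pencil_nonzero_at_top:
  fixes A :: "real^'n^'n"
  shows "\<exists>K. \<forall>x>K. \<forall>S\<in>sign_matrices. det (pencil A S x) \<noteq> 0"
proof -
  obtain K where K: "\<And>v. norm (A *v v) \<le> norm v * K"
    using bounded_linear.bounded[OF matrix_vector_mul_bounded_linear[of A]] by blast
  have "det (pencil A S x) \<noteq> 0" if "x > max K 0" "S \<in> sign_matrices" for x S
  proof
    assume "det (pencil A S x) = 0"
    then obtain v where v: "v \<noteq> 0" "pencil A S x *v v = 0"
      using det_zero_iff_kernel by blast
    then have "norm (x *\<^sub>R (S *v v)) = norm (A *v v)"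
      by (simp add: pencil_mult)
    then have "x * norm v \<le> K * norm v"
      using K[of v] that by (simp add: norm_sign_matrix_mult mult.commute)
    then show False
      using v that by simp
  qed
  then show ?thesis
    by blast
qed

lemma charpoly_sign_nonzero:
  assumes "S \<in> sign_matrices"
  shows "charpoly (S ** A) \<noteq> 0"
proof
  assume "charpoly (S ** A) = 0"
  then have "det (pencil A S x) = 0" for x
    using poly_charpoly[OF assms, of A x] det_sign_matrix_nonzero[OF assms] by simp
  then show False
    using det_pencil_nonzero_at_top[of A] assms gt_ex by blast
qed

lemma finite_singular_pencil:
  assumes "S \<in> sign_matrices"
  shows "finite {x. det (pencil A S x) = 0}"
proof -
  have "det (pencil A S x) = 0 \<longleftrightarrow> poly (charpoly (S ** A)) x = 0" for x
    using poly_charpoly[OF assms] det_sign_matrix_nonzero[OF assms] by simp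
  then show ?thesis
    using poly_roots_finite[OF charpoly_sign_nonzero[OF assms]] by simp
qed

section \<open>Positive solutions for a generic right-hand side\<close>

lemma eventually_at_notin_finite:
  fixes t :: "'a::t1_space"
  assumes "finite Z"
  shows "\<forall>\<^sub>F x in at t. x \<notin> Z"
proof -
  have "open (- (Z - {t}))"
    using assms by (intro open_Compl finite_imp_closed) auto
  then show ?thesis
    unfolding eventually_at_topological by blast
qed

lemma pos_divide_iff_sgn:
  fixes a b k :: real
  assumes "sgn a = sgn k" "b \<noteq> 0" "k \<noteq> 0"
  shows "0 < a / b \<longleftrightarrow> sgn k = sgn b"
  using assms by (cases a "0::real" rule: linorder_cases; cases b "0::real" rule: linorder_cases;
      cases k "0::real" rule: linorder_cases) (auto simp: zero_less_divide_iff)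

lemma pos_divide_eq_iff_sgn:
  fixes a b c :: real
  assumes "a \<noteq> 0" "b \<noteq> 0" "c \<noteq> 0"
  shows "(0 < a / b \<longleftrightarrow> 0 < a / c) \<longleftrightarrow> sgn b = sgn c"
  using assms by (cases a "0::real" rule: linorder_cases; cases b "0::real" rule: linorder_cases;
      cases c "0::real" rule: linorder_cases) (auto simp: zero_less_divide_iff)

text \<open>\<open>rhs_nonzero\<close> fixes the signs of solutions for large \<open>x\<close>;
  \<open>rhs_outside_range\<close> leaves singular pencils without solutions;
  \<open>rhs_single_zero\<close> lets a solution meet only one wall at a time;
  \<open>rhs_preimage_nonzero\<close> keeps solutions at \<open>x = 0\<close> off the walls.\<close>

locale generic_pencil =
  fixes A :: "real^'n^'n" and y :: "real^'n"
  assumes generic: "generic_matrix A"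
    and rhs_nonzero: "y $ i \<noteq> 0"
    and rhs_outside_range:
      "S \<in> sign_matrices \<Longrightarrow> det (pencil A S x) = 0 \<Longrightarrow> pencil A S x *v v \<noteq> y"
    and rhs_single_zero:
      "S \<in> sign_matrices \<Longrightarrow> pencil A S x *v v = y \<Longrightarrow> v $ i = 0 \<Longrightarrow> v $ j = 0 \<Longrightarrow> i = j"
    and rhs_preimage_nonzero: "A *v v = y \<Longrightarrow> v $ i \<noteq> 0"
begin

definition positive :: "real^'n^'n \<Rightarrow> real \<Rightarrow> bool" where
  "positive S x \<longleftrightarrow> (\<exists>v. (\<forall>i. 0 < v $ i) \<and> pencil A S x *v v = y)"

text \<open>Compactness in homogeneous coordinates \<open>(v, r)\<close>, which treat solutions of bounded and of
  diverging norm alike.\<close>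

lemma eventually_not_positive:
  assumes S: "S \<in> sign_matrices"
    and ker: "\<And>v. (\<forall>i. 0 \<le> v $ i) \<Longrightarrow> pencil A S t *v v = 0 \<Longrightarrow> v = 0"
    and sol: "\<And>v. (\<forall>i. 0 \<le> v $ i) \<Longrightarrow> pencil A S t *v v \<noteq> y"
  shows "\<forall>\<^sub>F x in at t. \<not> positive S x"
proof -
  define K where "K = {z :: (real^'n) \<times> real. (\<forall>i. 0 \<le> fst z $ i) \<and> 0 \<le> snd z} \<inter> sphere 0 1"
  define f where "f z = norm (pencil A S t *v fst z - snd z *\<^sub>R y)" for z :: "(real^'n) \<times> real"
  have "closed {z :: (real^'n) \<times> real. (\<forall>i. 0 \<le> fst z $ i) \<and> 0 \<le> snd z}"
    by (intro closed_Collect_conj closed_Collect_all closed_Collect_le continuous_intros)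
  then have "compact K"
    unfolding K_def by (intro closed_Int_compact) auto
  moreover have "(0, 1) \<in> K"
    by (auto simp: K_def norm_Pair)
  moreover have "continuous_on K f"
    unfolding f_def
    by (intro continuous_intros linear_continuous_on_compose[OF _ matrix_vector_mul_linear])
  ultimately obtain z where z: "z \<in> K" "\<And>w. w \<in> K \<Longrightarrow> f z \<le> f w"
    using continuous_attains_inf[of K f] by blast
  \<comment> \<open>A zero of \<open>f\<close> on \<open>K\<close> would be a nonnegative kernel
    vector if its last coordinate is 0, and otherwise a nonnegative solution after division by that
    coordinate.\<close>
  have "f z > 0"
  proof (rule ccontr)
    assume "\<not> f z > 0"
    then have eq: "pencil A S t *v fst z = snd z *\<^sub>R y"
      by (simp add: f_def)
    have nonneg: "\<forall>i. 0 \<le> fst z $ i" "0 \<le> snd z" and "z \<noteq> 0"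
      using z(1) by (auto simp: K_def)
    show False
    proof (cases "snd z = 0")
      case True
      then show ?thesis
        using ker[of "fst z"] eq nonneg \<open>z \<noteq> 0\<close> by (simp add: prod_eq_iff)
    next
      case False
      then have "pencil A S t *v (inverse (snd z) *\<^sub>R fst z) = y"
        by (simp add: matrix_scaleR_vector_ac scaleR_matrix_vector_assoc[symmetric] eq)
      then show ?thesis
        using sol[of "inverse (snd z) *\<^sub>R fst z"] nonneg by simp
    qed
  qed
  \<comment> \<open>Normalised into \<open>K\<close>, a positive solution at \<open>x\<close> has
    \<open>f\<close> at most \<open>dist x t\<close>, so \<open>x\<close> cannot be closer to
    \<open>t\<close> than the minimum of \<open>f\<close>.\<close>
  moreover have "\<not> positive S x" if "dist x t < f z" for x
  proof
    assume "positive S x"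
    then obtain v where v: "\<forall>i. 0 < v $ i" "pencil A S x *v v = y"
      by (auto simp: positive_def)
    define r where "r = norm (v, 1 :: real)"
    have r: "r > 0" "norm v \<le> r"
      unfolding r_def using norm_fst_le[of v "1::real"] by (auto simp: zero_prod_def)
    have "norm (inverse r *\<^sub>R (v, 1 :: real)) = 1"
      using r(1) by (simp only: norm_scaleR r_def[symmetric]) simp
    then have "inverse r *\<^sub>R (v, 1) \<in> K"
      using v r(1) by (auto simp: K_def less_imp_le)
    then have "f z \<le> f (inverse r *\<^sub>R (v, 1))"
      using z(2) by blast
    also have "\<dots> = norm (inverse r *\<^sub>R (pencil A S t *v v - pencil A S x *v v))"
      by (simp add: f_def v matrix_scaleR_vector_ac scaleR_matrix_vector_assoc[symmetric]
          scaleR_diff_right)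
    also have "pencil A S t *v v - pencil A S x *v v = (t - x) *\<^sub>R (S *v v)"
      by (simp add: pencil_mult scaleR_diff_left)
    also have "norm (inverse r *\<^sub>R \<dots>) = dist x t * (norm v / r)"
      unfolding norm_scaleR norm_sign_matrix_mult[OF S]
      using r by (simp add: dist_real_def field_simps abs_minus_commute)
    also have "\<dots> \<le> dist x t * 1"
      using r by (intro mult_left_mono) auto
    finally show False
      using that by simp
  qed
  ultimately show ?thesis
    unfolding eventually_at by blast
qed

lemma nonneg_kernel_positive:
  assumes "t \<ge> 0" "S \<in> sign_matrices" "\<forall>i. 0 \<le> v $ i" "v \<noteq> 0" "pencil A S t *v v = 0"
  shows "aligned_trio A t S (inverse (norm v) *\<^sub>R v)" and "\<forall>i. 0 < v $ i"
    and "simple_eigenvalue (S ** A) t"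
proof -
  show *: "aligned_trio A t S (inverse (norm v) *\<^sub>R v)"
    using assms by (simp add: aligned_trio_iff matrix_scaleR_vector_ac
        scaleR_matrix_vector_assoc[symmetric])
  then show "simple_eigenvalue (S ** A) t"
    using generic by (auto simp: generic_matrix_def)
  have "\<forall>i. 0 < (inverse (norm v) *\<^sub>R v) $ i"
    using * generic unfolding generic_matrix_def by blast
  then show "\<forall>i. 0 < v $ i"
    using assms(4) by (simp add: zero_less_mult_iff)
qed

text \<open>A kernel vector independent of \<open>v\<close> could be subtracted from \<open>v\<close> until the boundary of the
  orthant is reached.\<close>

lemma nonneg_kernel_unique:
  assumes "t \<ge> 0" "S \<in> sign_matrices" "\<forall>i. 0 \<le> v $ i" "v \<noteq> 0" "pencil A S t *v v = 0"
    and u: "pencil A S t *v u = 0"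
  shows "\<exists>k. u = k *\<^sub>R v"
proof -
  have v: "0 < v $ i" for i
    using nonneg_kernel_positive[OF assms(1-5)] by blast
  \<comment> \<open>The largest multiple of \<open>v\<close> that can be taken off \<open>u\<close>
    without leaving the nonnegative orthant. The remainder has a zero coordinate, so as a kernel
    vector it must vanish.\<close>
  define k where "k = Min (range (\<lambda>i. u $ i / v $ i))"
  define w where "w = u - k *\<^sub>R v"
  have "k \<le> u $ i / v $ i" for i
    unfolding k_def by (rule Min_le) auto
  then have w: "\<forall>i. 0 \<le> w $ i"
    using v by (simp add: w_def field_simps)
  have "k \<in> range (\<lambda>i. u $ i / v $ i)"
    unfolding k_def by (rule Min_in) auto
  then obtain i where "k = u $ i / v $ i"
    by blast
  then have "w $ i = 0"
    using v[of i] by (simp add: w_def)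
  moreover have "pencil A S t *v w = 0"
    by (simp add: w_def matrix_vector_mult_diff_distrib u assms(5) matrix_scaleR_vector_ac
        scaleR_matrix_vector_assoc[symmetric])
  ultimately have "w = 0"
    using nonneg_kernel_positive(2)[OF assms(1,2) w] by (metis less_irrefl)
  then show ?thesis
    by (auto simp: w_def)
qed

section \<open>Cramer's rule: solutions as rational functions of the parameter\<close>

definition pencil_det :: "real^'n^'n \<Rightarrow> real poly" where
  "pencil_det S = det (\<chi> a b. [:- A $ a $ b, S $ a $ b:])"

definition cramer_numerator :: "real^'n^'n \<Rightarrow> 'n \<Rightarrow> real poly" where
  "cramer_numerator S i = det (\<chi> a b. if b = i then [:y $ a:] else [:- A $ a $ b, S $ a $ b:])"

text \<open>At a root of \<open>pencil_det S\<close> division by zero makes this the zero vector; it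
  solves the system only at nonsingular \<open>x\<close>.\<close>

definition solution :: "real^'n^'n \<Rightarrow> real \<Rightarrow> real^'n" where
  "solution S x = (\<chi> i. poly (cramer_numerator S i) x / poly (pencil_det S) x)"

lemma poly_pencil_det: "poly (pencil_det S) x = det (pencil A S x)"
  by (simp add: pencil_det_def poly_det pencil_def)
     (intro arg_cong[where f = det], simp add: vec_eq_iff)

lemma poly_cramer_numerator:
  "poly (cramer_numerator S i) x = det (\<chi> a b. if b = i then y $ a else pencil A S x $ a $ b)"
  by (simp add: cramer_numerator_def poly_det pencil_def)
     (intro arg_cong[where f = det], simp add: vec_eq_iff pencil_def)

lemma solution_iff:
  "poly (pencil_det S) x \<noteq> 0 \<Longrightarrow> pencil A S x *v v = y \<longleftrightarrow> v = solution S x"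
  by (simp add: solution_def poly_pencil_det poly_cramer_numerator cramer)

lemma positive_iff:
  "poly (pencil_det S) x \<noteq> 0 \<Longrightarrow> positive S x \<longleftrightarrow> (\<forall>i. 0 < solution S x $ i)"
  by (auto simp: positive_def solution_iff)

text \<open>Turns simplicity of an eigenvalue of \<open>S ** A\<close> into simplicity of a root of
  \<open>pencil_det S\<close>, as \<open>det S\<close> is a nonzero constant.\<close>

lemma charpoly_eq_pencil_det:
  assumes "S \<in> sign_matrices"
  shows "charpoly (S ** A) = smult (det S) (pencil_det S)"
  by (rule poly_eq_poly_eq_iff[THEN iffD1]) (simp add: fun_eq_iff poly_charpoly[OF assms] poly_pencil_det)

lemma pencil_det_nonzero: "S \<in> sign_matrices \<Longrightarrow> pencil_det S \<noteq> 0"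
  using charpoly_eq_pencil_det charpoly_sign_nonzero by fastforce

lemma singular_kernel_trivial:
  "poly (pencil_det S) x \<noteq> 0 \<Longrightarrow> pencil A S x *v v = 0 \<Longrightarrow> v = 0"
  using det_zero_iff_kernel poly_pencil_det by metis

section \<open>Positivity near a fixed parameter value\<close>

lemma tendsto_solution:
  assumes "poly (pencil_det S) t \<noteq> 0"
  shows "((\<lambda>x. solution S x $ i) \<longlongrightarrow> solution S t $ i) (at t)"
  unfolding solution_def vec_lambda_beta using assms by (auto intro!: tendsto_intros)

lemma eventually_pencil_det_nonzero:
  assumes "S \<in> sign_matrices"
  shows "\<forall>\<^sub>F x in at t. poly (pencil_det S) x \<noteq> 0"
  using eventually_at_notin_finite[OF poly_roots_finite[OF pencil_det_nonzero[OF assms]]] by simp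

lemma eventually_positive:
  assumes S: "S \<in> sign_matrices" "poly (pencil_det S) t \<noteq> 0" "\<And>i. 0 < solution S t $ i"
  shows "\<forall>\<^sub>F x in at t. positive S x"
proof -
  have "\<forall>\<^sub>F x in at t. 0 < solution S x $ i" for i
    using order_tendstoD(1)[OF tendsto_solution[OF S(2)] S(3)] .
  then have "\<forall>\<^sub>F x in at t. \<forall>i. 0 < solution S x $ i"
    by (simp add: eventually_all_finite)
  then show ?thesis
    using eventually_pencil_det_nonzero[OF S(1)]
    by eventually_elim (simp add: positive_iff)
qed

text \<open>Off the walls the solution is either inside the open orthant, where continuity applies,
  or has a negative coordinate, where \<open>eventually_not_positive\<close> applies.\<close>

lemma regular_constant:
  assumes S: "S \<in> sign_matrices" and det: "poly (pencil_det S) t \<noteq> 0"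
    and nz: "\<And>i. solution S t $ i \<noteq> 0"
  shows "\<exists>q. \<forall>\<^sub>F x in at t. positive S x = q"
proof (cases "\<forall>i. 0 \<le> solution S t $ i")
  case True
  then have "\<forall>\<^sub>F x in at t. positive S x"
    using nz by (intro eventually_positive[OF S det]) (simp add: less_le)
  then show ?thesis
    by (intro exI[of _ True]) simp
next
  case False
  then have "\<forall>\<^sub>F x in at t. \<not> positive S x"
    using singular_kernel_trivial[OF det] solution_iff[OF det]
    by (intro eventually_not_positive[OF S]) auto
  then show ?thesis
    by (intro exI[of _ False]) simp
qed

lemma eventually_sgn_poly_const:
  fixes p :: "real poly"
  assumes "poly p t \<noteq> 0"
  shows "\<forall>\<^sub>F x in at t. sgn (poly p x) = sgn (poly p t)"
proof -
  have lim: "(poly p \<longlongrightarrow> poly p t) (at t)"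
    by (intro tendsto_intros)
  consider "poly p t > 0" | "poly p t < 0"
    using assms by linarith
  then show ?thesis
  proof cases
    case 1
    then show ?thesis
      using order_tendstoD(1)[OF lim 1] by (auto elim: eventually_mono)
  next
    case 2
    then show ?thesis
      using order_tendstoD(2)[OF lim 2] by (auto elim: eventually_mono)
  qed
qed

text \<open>The flipped entry lies in column \<open>k\<close>, which Cramer's rule replaces by
  \<open>y\<close>.\<close>

lemma cramer_numerator_flip: "cramer_numerator (flip k S) k = cramer_numerator S k"
  by (auto simp: cramer_numerator_def flip_component intro!: arg_cong[where f = det] simp: vec_eq_iff)

lemma pencil_flip_mult:
  assumes "S \<in> sign_matrices" "v $ k = 0"
  shows "pencil A (flip k S) x *v v = pencil A S x *v v"
  using assms by (simp add: pencil_mult vec_eq_iff sign_matrix_vector_component flip_component)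

text \<open>The two pencils agree on vectors with vanishing coordinate \<open>k\<close>, so the
  solution is shared; \<open>rhs_outside_range\<close> then excludes a singular flipped
  pencil.\<close>

lemma wall_flip:
  assumes S: "S \<in> sign_matrices" and det: "poly (pencil_det S) t \<noteq> 0"
    and wall: "solution S t $ k = 0"
  shows "poly (pencil_det (flip k S)) t \<noteq> 0" and "solution (flip k S) t = solution S t"
proof -
  have eq: "pencil A (flip k S) t *v solution S t = y"
    using pencil_flip_mult[OF S wall] solution_iff[OF det] by simp
  show *: "poly (pencil_det (flip k S)) t \<noteq> 0"
    using rhs_outside_range[OF flip_in_sign_matrices[OF S]] eq poly_pencil_det by metis
  show "solution (flip k S) t = solution S t"
    using solution_iff[OF *] eq by simp
qed

text \<open>The other coordinates keep their signs near \<open>t\<close>. Coordinate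
  \<open>k\<close> is the same numerator over two determinants: if these have equal signs at
  \<open>t\<close>, both matrices count or neither does; if opposite, exactly one counts.\<close>

lemma wall_constant:
  assumes S: "S \<in> sign_matrices" and det: "poly (pencil_det S) t \<noteq> 0"
    and wall: "solution S t $ k = 0" and num: "cramer_numerator S k \<noteq> 0"
  shows "\<exists>q. \<forall>\<^sub>F x in at t. (positive S x \<longleftrightarrow> positive (flip k S) x) = q"
proof -
  note S' = flip_in_sign_matrices[OF S, of k]
  note det' = wall_flip(1)[OF S det wall] and sol' = wall_flip(2)[OF S det wall]
  have nz: "solution S t $ i \<noteq> 0" if "i \<noteq> k" for i
    using rhs_single_zero[OF S, of t "solution S t" i k] solution_iff[OF det] wall that by auto
  show ?thesis
  proof (cases "\<forall>i. 0 \<le> solution S t $ i")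
    case False
    then have "\<forall>\<^sub>F x in at t. \<not> positive S x"
      using singular_kernel_trivial[OF det] solution_iff[OF det]
      by (intro eventually_not_positive[OF S]) auto
    moreover have "\<forall>\<^sub>F x in at t. \<not> positive (flip k S) x"
      using False singular_kernel_trivial[OF det'] solution_iff[OF det'] sol'
      by (intro eventually_not_positive[OF S']) auto
    ultimately have "\<forall>\<^sub>F x in at t. (positive S x \<longleftrightarrow> positive (flip k S) x) = True"
      by eventually_elim simp
    then show ?thesis
      by blast
  next
    case True
    have pos: "0 < solution S t $ i" if "i \<noteq> k" for i
      using True nz[OF that] by (simp add: less_le)
    have others: "\<forall>\<^sub>F x in at t. \<forall>i. i \<noteq> k \<longrightarrow> 0 < solution T x $ i"
      if "poly (pencil_det T) t \<noteq> 0" "solution T t = solution S t" for T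
      using order_tendstoD(1)[OF tendsto_solution[OF that(1)], of 0] pos that(2)
      by (intro eventually_all_finite) (auto intro: always_eventually)
    let ?p = "poly (cramer_numerator S k)" and ?d = "poly (pencil_det S)"
      and ?d' = "poly (pencil_det (flip k S))"
    \<comment> \<open>Roots of a nonzero polynomial are isolated, so coordinate \<open>k\<close> is
      off the wall on both sides of \<open>t\<close>.\<close>
    have "\<forall>\<^sub>F x in at t. ?p x \<noteq> 0"
      using eventually_at_notin_finite[OF poly_roots_finite[OF num]] by simp
    then have "\<forall>\<^sub>F x in at t. (positive S x \<longleftrightarrow> positive (flip k S) x) = (sgn (?d t) = sgn (?d' t))"
      using others[OF det refl] others[OF det' sol'] eventually_sgn_poly_const[OF det]
        eventually_sgn_poly_const[OF det'] eventually_pencil_det_nonzero[OF S]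
        eventually_pencil_det_nonzero[OF S']
    proof eventually_elim
      case (elim x)
      have "positive S x \<longleftrightarrow> 0 < solution S x $ k"
        using elim by (metis positive_iff)
      moreover have "positive (flip k S) x \<longleftrightarrow> 0 < solution (flip k S) x $ k"
        using elim by (metis positive_iff)
      moreover have "solution S x $ k = ?p x / ?d x" "solution (flip k S) x $ k = ?p x / ?d' x"
        by (simp_all add: solution_def cramer_numerator_flip)
      ultimately show ?case
        using elim pos_divide_eq_iff_sgn by simp
    qed
    then show ?thesis
      by blast
  qed
qed

text \<open>Continuity extends Cramer's identity to a singular \<open>t\<close>, both as it stands
  and after cancelling a common factor.\<close>

lemma pencil_poly_identity_at:
  assumes "\<forall>\<^sub>F x in at t. pencil A S x *v (\<chi> i. poly (q i) x) = poly e x *\<^sub>R y"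
  shows "pencil A S t *v (\<chi> i. poly (q i) t) = poly e t *\<^sub>R y"
proof (rule tendsto_unique)
  have "((\<lambda>x. \<chi> i. poly (q i) x) \<longlongrightarrow> (\<chi> i. poly (q i) t)) (at t)"
    by (intro tendsto_intros)
  then show "((\<lambda>x. pencil A S x *v (\<chi> i. poly (q i) x)) \<longlongrightarrow> pencil A S t *v (\<chi> i. poly (q i) t)) (at t)"
    unfolding pencil_mult
    by (intro tendsto_intros bounded_linear.tendsto[OF matrix_vector_mul_bounded_linear])
  have "((\<lambda>x. poly e x *\<^sub>R y) \<longlongrightarrow> poly e t *\<^sub>R y) (at t)"
    by (intro tendsto_intros)
  then show "((\<lambda>x. pencil A S x *v (\<chi> i. poly (q i) x)) \<longlongrightarrow> poly e t *\<^sub>R y) (at t)"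
    by (rule Lim_transform_eventually) (use assms in \<open>auto elim: eventually_mono\<close>)
qed simp

text \<open>By Cramer's rule the solution is a quotient of polynomials. At an aligned value the numerators
  tend to a nonzero multiple of the positive eigenvector, while the denominator has a simple
  zero and so changes sign.\<close>

lemma aligned_jump:
  assumes t: "t \<ge> 0" and S: "S \<in> sign_matrices"
    and v: "\<forall>i. 0 \<le> v $ i" "v \<noteq> 0" "pencil A S t *v v = 0"
  shows "\<exists>q. (\<forall>\<^sub>F x in at_left t. positive S x = q) \<and> (\<forall>\<^sub>F x in at_right t. positive S x = (\<not> q))"
proof -
  let ?d = "pencil_det S" and ?p = "cramer_numerator S"
  note det_ev = eventually_pencil_det_nonzero[OF S, of t]
  have "order t ?d = 1"
    using nonneg_kernel_positive(3)[OF t S v] det_sign_matrix_nonzero[OF S]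
    by (simp add: simple_eigenvalue_def charpoly_eq_pencil_det[OF S] order_smult)
  then obtain e where e: "?d = [:- t, 1:] * e" and "\<not> [:- t, 1:] dvd e"
    using order_decomp[OF pencil_det_nonzero[OF S], of t] by auto
  then have e0: "poly e t \<noteq> 0"
    by (simp add: poly_eq_0_iff_dvd)
  have d_eq: "poly ?d x = (x - t) * poly e x" for x
    by (simp add: e algebra_simps)
  have det0: "det (pencil A S t) = 0"
    using d_eq[of t] by (simp add: poly_pencil_det)
  have G: "pencil A S x *v (\<chi> i. poly (?p i) x) = poly ?d x *\<^sub>R y" if "poly ?d x \<noteq> 0" for x
  proof -
    have "(\<chi> i. poly (?p i) x) = poly ?d x *\<^sub>R solution S x"
      using that by (simp add: solution_def vec_eq_iff)
    then show ?thesis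
      using solution_iff[OF that, of "solution S x"]
      by (simp add: matrix_scaleR_vector_ac scaleR_matrix_vector_assoc[symmetric])
  qed
  have "pencil A S t *v (\<chi> i. poly (?p i) t) = 0"
    using pencil_poly_identity_at[OF eventually_mono[OF det_ev G]] d_eq[of t] by simp
  then obtain k where k: "(\<chi> i. poly (?p i) t) = k *\<^sub>R v"
    using nonneg_kernel_unique[OF t S v] by blast
  \<comment> \<open>Otherwise every numerator is divisible by \<open>x - t\<close>. Cancelling this
    factor on both sides and passing to \<open>t\<close> gives a solution of the singular system,
    since \<open>poly e t\<close> is nonzero.\<close>
  have "k \<noteq> 0"
  proof
    assume "k = 0"
    then have "\<forall>i. poly (?p i) t = 0"
      using k by (simp add: vec_eq_iff)
    then have "\<forall>i. \<exists>q. ?p i = [:- t, 1:] * q"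
      by (auto simp: poly_eq_0_iff_dvd dvd_def)
    then obtain q where q: "\<And>i. ?p i = [:- t, 1:] * q i"
      by metis
    have "\<forall>\<^sub>F x in at t. pencil A S x *v (\<chi> i. poly (q i) x) = poly e x *\<^sub>R y"
      using det_ev
    proof eventually_elim
      case (elim x)
      then have "x \<noteq> t"
        using d_eq by auto
      have "(\<chi> i. poly (?p i) x) = (x - t) *\<^sub>R (\<chi> i. poly (q i) x)"
        by (simp add: q vec_eq_iff algebra_simps)
      then have "(x - t) *\<^sub>R (pencil A S x *v (\<chi> i. poly (q i) x)) = (x - t) *\<^sub>R (poly e x *\<^sub>R y)"
        using G[OF elim] by (simp add: d_eq matrix_scaleR_vector_ac scaleR_matrix_vector_assoc[symmetric])
      then show ?case
        using \<open>x \<noteq> t\<close> by (simp del: scaleR_scaleR)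
    qed
    then have "pencil A S t *v (\<chi> i. poly (q i) t) = poly e t *\<^sub>R y"
      by (rule pencil_poly_identity_at)
    then have "pencil A S t *v (inverse (poly e t) *\<^sub>R (\<chi> i. poly (q i) t)) = y"
      using e0 by (simp add: matrix_scaleR_vector_ac scaleR_matrix_vector_assoc[symmetric])
    then show False
      using rhs_outside_range[OF S det0] by blast
  qed
  have pt: "poly (?p i) t = k * v $ i" "v $ i > 0" for i
    using k nonneg_kernel_positive(2)[OF t S v] by (simp_all add: vec_eq_iff)
  have "\<forall>\<^sub>F x in at t. \<forall>i. sgn (poly (?p i) x) = sgn k"
  proof (rule eventually_all_finite)
    fix i
    show "\<forall>\<^sub>F x in at t. sgn (poly (?p i) x) = sgn k"
      using eventually_sgn_poly_const[of "?p i" t] pt[of i] \<open>k \<noteq> 0\<close> by (simp add: sgn_mult)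
  qed
  \<comment> \<open>All numerators have the sign of \<open>k\<close> near \<open>t\<close>, so all
    coordinates of the solution share one sign, which depends on the side of
    \<open>t\<close>.\<close>
  then have "\<forall>\<^sub>F x in at t. positive S x \<longleftrightarrow> sgn k = sgn (x - t) * sgn (poly e t)"
    using det_ev eventually_sgn_poly_const[OF e0]
  proof eventually_elim
    case (elim x)
    have "0 < solution S x $ i \<longleftrightarrow> sgn (poly ?d x) = sgn k" for i
      using elim \<open>k \<noteq> 0\<close> pos_divide_iff_sgn[of "poly (?p i) x" k "poly ?d x"]
      by (auto simp: solution_def)
    then show ?case
      using elim by (auto simp: positive_iff d_eq sgn_mult)
  qed
  then have "(\<forall>\<^sub>F x in at_left t. positive S x = (sgn k = - sgn (poly e t))) \<and>
    (\<forall>\<^sub>F x in at_right t. positive S x = (\<not> sgn k = - sgn (poly e t)))"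
    using e0 \<open>k \<noteq> 0\<close>
    by (auto simp: eventually_at_filter sgn_if elim!: eventually_mono split: if_splits)
  then show ?thesis
    by blast
qed

section \<open>The count for large parameters and near zero\<close>

lemma solution_sgn_at_top:
  "\<exists>K. \<forall>x>K. \<forall>S\<in>sign_matrices. poly (pencil_det S) x \<noteq> 0 \<and>
     (\<forall>i. sgn (solution S x $ i) = S $ i $ i * sgn (y $ i))"
proof -
  obtain K where K: "\<And>x S. x > K \<Longrightarrow> S \<in> sign_matrices \<Longrightarrow> det (pencil A S x) \<noteq> 0"
    using det_pencil_nonzero_at_top[of A] by blast
  obtain C where C: "C > 0" "\<And>v. norm (A *v v) \<le> norm v * C"
    using bounded_linear.pos_bounded[OF matrix_vector_mul_bounded_linear[of A]] by blast
  define m where "m = Min (range (\<lambda>i. \<bar>y $ i\<bar>))"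
  have m_le: "m \<le> \<bar>y $ i\<bar>" for i
    unfolding m_def by (rule Min_le) auto
  have "m \<in> range (\<lambda>i. \<bar>y $ i\<bar>)"
    unfolding m_def by (rule Min_in) auto
  then have "m > 0"
    using rhs_nonzero by auto
  \<comment> \<open>From \<open>x S v = A v + y\<close> follows
    \<open>(x - C) norm v <= norm y\<close>. The threshold on \<open>x\<close> then makes each
    coordinate of \<open>A v\<close> smaller in modulus than \<open>m\<close>, so \<open>y\<close>
    decides the signs.\<close>
  have "poly (pencil_det S) x \<noteq> 0 \<and> (\<forall>i. sgn (solution S x $ i) = S $ i $ i * sgn (y $ i))"
    if x: "x > max K (C + C * norm y / m)" and S: "S \<in> sign_matrices" for x S
  proof -
    define v where "v = solution S x"
    have d: "poly (pencil_det S) x \<noteq> 0"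
      using K[of x S] x S by (simp add: poly_pencil_det)
    have "C * norm y / m \<ge> 0"
      using C \<open>m > 0\<close> by simp
    then have "x > C" "x > 0"
      using x C by auto
    have eq: "x *\<^sub>R (S *v v) = A *v v + y"
      using solution_iff[OF d, of v] by (simp add: v_def pencil_mult algebra_simps)
    then have "x * norm v \<le> norm v * C + norm y"
      using norm_triangle_ineq[of "A *v v" y] C(2)[of v] \<open>x > 0\<close>
      by (metis (no_types, lifting) abs_of_pos add_right_mono norm_scaleR norm_sign_matrix_mult[OF S] order_trans)
    then have "C * ((x - C) * norm v) \<le> C * norm y"
      using C by (intro mult_left_mono) (simp_all add: algebra_simps)
    also have "\<dots> < m * (x - C)"
      using x \<open>m > 0\<close> by (simp add: field_simps)
    finally have "(x - C) * (C * norm v) < (x - C) * m"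
      by (simp add: algebra_simps)
    then have "C * norm v < m"
      using \<open>x > C\<close> by simp
    then have small: "\<bar>(A *v v) $ i\<bar> < \<bar>y $ i\<bar>" for i
      using C(2)[of v] component_le_norm_cart[of "A *v v" i] m_le[of i] by (simp add: mult.commute)
    have "sgn (v $ i) = S $ i $ i * sgn (y $ i)" for i
    proof -
      have "x * (S $ i $ i * v $ i) = (A *v v) $ i + y $ i"
        using arg_cong[OF eq, of "\<lambda>w. w $ i"] by (simp add: sign_matrix_vector_component[OF S])
      then have "sgn (x * (S $ i $ i * v $ i)) = sgn (y $ i)"
        using small[of i] by (auto simp: sgn_if)
      then have "sgn (S $ i $ i) * sgn (v $ i) = sgn (y $ i)"
        using \<open>x > 0\<close> by (simp add: sgn_mult)
      then show ?thesis
        using sign_matrix_diag[OF S, of i] by auto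
    qed
    then show ?thesis
      using d by (simp add: v_def)
  qed
  then show ?thesis
    by blast
qed

text \<open>For large \<open>x\<close> coordinate \<open>k\<close> of the solution has a nonzero
  sign. This supplies the last hypothesis of \<open>wall_constant\<close>.\<close>

lemma cramer_numerator_nonzero:
  assumes "S \<in> sign_matrices"
  shows "cramer_numerator S k \<noteq> 0"
proof
  assume "cramer_numerator S k = 0"
  then have "sgn (solution S x $ k) = 0" for x
    by (simp add: solution_def)
  moreover obtain K where "\<forall>x>K. sgn (solution S x $ k) = S $ k $ k * sgn (y $ k)"
    using solution_sgn_at_top assms by blast
  ultimately have "S $ k $ k * sgn (y $ k) = 0"
    using gt_ex[of K] by metis
  then show False
    using sign_matrix_diag[OF assms, of k] rhs_nonzero[of k] by (auto simp: sgn_if split: if_splits)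
qed

lemma card_positive_at_top: "\<forall>\<^sub>F x in at_top. card {S \<in> sign_matrices. positive S x} = 1"
proof -
  obtain K where K: "\<And>x S. x > K \<Longrightarrow> S \<in> sign_matrices \<Longrightarrow> poly (pencil_det S) x \<noteq> 0"
    "\<And>x S i. x > K \<Longrightarrow> S \<in> sign_matrices \<Longrightarrow> sgn (solution S x $ i) = S $ i $ i * sgn (y $ i)"
    using solution_sgn_at_top by blast
  \<comment> \<open>The signs of \<open>y\<close>: the one orthant that contains a solution for
    large \<open>x\<close>.\<close>
  define D :: "real^'n^'n" where "D = (\<chi> i j. if i = j then sgn (y $ i) else 0)"
  have D: "D \<in> sign_matrices"
    unfolding D_def by (rule diag_in_sign_matrices) (use rhs_nonzero in \<open>auto simp: sgn_if\<close>)
  have "positive S x \<longleftrightarrow> S = D" if "x > K" and S: "S \<in> sign_matrices" for S x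
  proof -
    have "positive S x \<longleftrightarrow> (\<forall>i. sgn (solution S x $ i) = 1)"
      using K(1)[OF that] by (simp add: positive_iff sgn_1_pos)
    also have "\<dots> \<longleftrightarrow> (\<forall>i. S $ i $ i = D $ i $ i)"
    proof (intro iff_allI)
      fix i
      show "sgn (solution S x $ i) = 1 \<longleftrightarrow> S $ i $ i = D $ i $ i"
        using K(2)[OF that, of i] sign_matrix_diag[OF S, of i] rhs_nonzero[of i]
        by (auto simp: D_def sgn_if split: if_splits)
    qed
    also have "\<dots> \<longleftrightarrow> S = D"
      using sign_matrix_eqI[OF S D] by auto
    finally show ?thesis .
  qed
  then have "{S \<in> sign_matrices. positive S x} = {D}" if "x > K" for x
    using that D by auto
  then show ?thesis
    unfolding eventually_at_top_dense by (intro exI[of _ K]) simp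
qed

text \<open>The pencil depends only on the product of \<open>x\<close> and \<open>S\<close>, so
  behaviour left of 0 for \<open>S\<close> mirrors that right of 0 for \<open>- S\<close>.\<close>

lemma positive_uminus: "positive (- S) (- x) = positive S x"
  by (simp add: positive_def pencil_def)

lemma card_eq_sum_of_bool: "finite B \<Longrightarrow> card {x \<in> B. P x} = (\<Sum>x\<in>B. of_bool (P x))"
  by (simp add: sum.If_cases of_bool_def Int_def)

text \<open>At \<open>x = 0\<close> every pencil equals \<open>- A\<close>, so one case holds for
  all \<open>S\<close> at once. With a nonnegative kernel vector each \<open>S\<close> toggles at 0,
  and exactly one of \<open>S\<close> and \<open>- S\<close> counts to the right; with a nonnegative
  solution all \<open>S\<close> count; otherwise none do.\<close>

lemma even_card_positive_at_zero:
  assumes "CARD('n) = 1 \<Longrightarrow> A \<noteq> 0"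
  shows "\<forall>\<^sub>F x in at_right 0. even (card {S \<in> sign_matrices. positive S x})"
proof -
  have pencil0: "pencil A S 0 *v v = - (A *v v)" for S v
    by (simp add: pencil_mult)
  consider (kernel) v where "\<forall>i. 0 \<le> v $ i" "v \<noteq> 0" "A *v v = 0"
    | (solution) v where "\<forall>i. 0 \<le> v $ i" "- (A *v v) = y"
    | (none) "\<And>v. (\<forall>i. 0 \<le> v $ i) \<Longrightarrow> A *v v = 0 \<Longrightarrow> v = 0"
        "\<And>v. (\<forall>i. 0 \<le> v $ i) \<Longrightarrow> - (A *v v) \<noteq> y"
    by blast
  then show ?thesis
  proof cases
    case kernel
    have card: "CARD('n) \<noteq> 1"
    \<comment> \<open>In dimension one a nonzero kernel vector forces \<open>A = 0\<close>, the
      excluded case.\<close>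
    proof
      assume *: "CARD('n) = 1"
      then obtain k where k: "(UNIV :: 'n set) = {k}"
        using card_1_singletonE by blast
      then have all: "i = k" for i :: 'n
        by (metis UNIV_I singletonD)
      have "A $ k $ k * v $ k = 0"
        using arg_cong[OF kernel(3), of "\<lambda>w. w $ k"] by (simp add: matrix_vector_mult_def k)
      moreover have "v $ k \<noteq> 0"
        using kernel(2) by (metis all vec_eq_iff zero_index)
      ultimately have "A = 0"
        by (metis all mult_eq_0_iff vec_eq_iff zero_index)
      then show False
        using assms[OF *] by simp
    qed
    \<comment> \<open>An arbitrary index, whose sign selects one matrix from each pair
      \<open>S\<close>, \<open>- S\<close>.\<close>
    define k :: 'n where "k = undefined"
    have "\<forall>\<^sub>F x in at_right 0. positive (- S) x \<noteq> positive S x" if S: "S \<in> sign_matrices" for S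
    proof -
      obtain q where q: "\<forall>\<^sub>F x in at_left 0. positive S x = q" "\<forall>\<^sub>F x in at_right 0. positive S x = (\<not> q)"
        using aligned_jump[OF order_refl S kernel(1,2)] kernel(3) by (auto simp: pencil0)
      have "\<forall>\<^sub>F x in at_right 0. positive S (- x) = q"
        using q(1) by (simp add: at_left_minus eventually_filtermap)
      then show ?thesis
        using q(2) by eventually_elim (metis minus_minus positive_uminus)
    qed
    then have "\<forall>\<^sub>F x in at_right 0. \<forall>S\<in>sign_matrices. positive (- S) x \<noteq> positive S x"
      by (simp add: eventually_ball_finite finite_sign_matrices)
    then show ?thesis
    proof eventually_elim
      case (elim x)
      have "card {S \<in> sign_matrices. positive S x} = (\<Sum>S\<in>sign_matrices. of_bool (positive S x))"
        by (rule card_eq_sum_of_bool[OF finite_sign_matrices])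
      also have "\<dots> = (\<Sum>S\<in>{S \<in> sign_matrices. S $ k $ k = 1}. of_bool (positive S x) + of_bool (positive (- S) x))"
        by (rule sum_involution[OF finite_sign_matrices])
           (use sign_matrix_diag in \<open>fastforce\<close>)
      also have "\<dots> = (\<Sum>S\<in>{S \<in> sign_matrices. S $ k $ k = 1}. 1)"
        by (rule sum.cong) (use elim in auto)
      finally show ?case
        using even_card_half_sign_matrices[OF card, of k] by simp
    qed
  next
    case solution
    have "\<forall>\<^sub>F x in at_right 0. positive S x" if S: "S \<in> sign_matrices" for S
    proof -
      have d: "poly (pencil_det S) 0 \<noteq> 0"
        using rhs_outside_range[OF S, of 0 v] solution(2) by (auto simp: poly_pencil_det pencil0)
      have v: "v = local.solution S 0"
        using solution_iff[OF d, of v] solution(2) by (simp add: pencil0)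
      have "v $ i \<noteq> 0" for i
        using rhs_preimage_nonzero[of "- v" i] solution(2)
          matrix_vector_mult_diff_distrib[of A 0 v] by simp
      then have "\<forall>\<^sub>F x in at 0. positive S x"
        using solution(1) by (intro eventually_positive[OF S d]) (simp add: v[symmetric] less_le)
      then show ?thesis
        by (rule filter_leD[OF at_le, rotated]) simp
    qed
    then have "\<forall>\<^sub>F x in at_right 0. \<forall>S\<in>sign_matrices. positive S x"
      by (simp add: eventually_ball_finite finite_sign_matrices)
    then show ?thesis
    proof eventually_elim
      case (elim x)
      then have "{S \<in> sign_matrices. positive S x} = sign_matrices"
        by auto
      then show ?case
        by (simp add: even_card_sign_matrices)
    qed
  next
    case none
    have "\<forall>\<^sub>F x in at_right 0. \<not> positive S x" if S: "S \<in> sign_matrices" for S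
    proof -
      have "\<forall>\<^sub>F x in at 0. \<not> positive S x"
        by (rule eventually_not_positive[OF S]) (use none in \<open>auto simp: pencil0\<close>)
      then show ?thesis
        by (rule filter_leD[OF at_le, rotated]) simp
    qed
    then have "\<forall>\<^sub>F x in at_right 0. \<forall>S\<in>sign_matrices. \<not> positive S x"
      by (simp add: eventually_ball_finite finite_sign_matrices)
    then show ?thesis
    proof eventually_elim
      case (elim x)
      then have "{S \<in> sign_matrices. positive S x} = {}"
        by auto
      then show ?case
        by (metis card.empty even_zero)
    qed
  qed
qed

end

section \<open>Parity of counts along the positive half-line\<close>

lemma eventually_even_sum:
  fixes h :: "'a \<Rightarrow> 'b \<Rightarrow> nat"
  assumes "finite B" "\<And>S. S \<in> B \<Longrightarrow> \<exists>q. \<forall>\<^sub>F x in F. even (h S x) = q"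
  shows "\<exists>q. \<forall>\<^sub>F x in F. even (\<Sum>S\<in>B. h S x) = q"
  using assms
proof (induction B rule: finite_induct)
  case empty
  show ?case
    by (intro exI[of _ True]) simp
next
  case (insert S B)
  then obtain q r where "\<forall>\<^sub>F x in F. even (h S x) = q" "\<forall>\<^sub>F x in F. even (\<Sum>S\<in>B. h S x) = r"
    by blast
  then have "\<forall>\<^sub>F x in F. even (\<Sum>S\<in>insert S B. h S x) = (q = r)"
    by eventually_elim (use insert.hyps in auto)
  then show ?case
    by blast
qed

text \<open>Elements are counted strictly below \<open>x\<close>, so \<open>t\<close> itself enters
  only to the right of \<open>t\<close>.\<close>

lemma card_below_jump:
  fixes E :: "real set"
  assumes "finite E"
  shows "\<forall>\<^sub>F x in at_left t. card (E \<inter> {..<x}) = card (E \<inter> {..<t})"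
    and "\<forall>\<^sub>F x in at_right t. card (E \<inter> {..<x}) = card (E \<inter> {..<t}) + of_bool (t \<in> E)"
proof -
  obtain d where d: "d > 0" "\<And>x. x \<noteq> t \<Longrightarrow> dist x t < d \<Longrightarrow> x \<notin> E"
    using eventually_at_notin_finite[OF assms, of t] unfolding eventually_at by auto
  have "card (E \<inter> {..<x}) = card (E \<inter> {..<t})" if "x < t" "x > t - d" for x
  proof -
    have "E \<inter> {..<x} = E \<inter> {..<t}"
    proof (intro equalityI subsetI)
      fix c assume c: "c \<in> E \<inter> {..<t}"
      then have "\<not> dist c t < d"
        using d(2)[of c] by auto
      then show "c \<in> E \<inter> {..<x}"
        using c that by (auto simp: dist_real_def)
    qed (use that in auto)
    then show ?thesis
      by simp
  qed
  then show "\<forall>\<^sub>F x in at_left t. card (E \<inter> {..<x}) = card (E \<inter> {..<t})"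
    using d(1) by (intro eventually_at_leftI[of "t - d"]) auto
  have "card (E \<inter> {..<x}) = card (E \<inter> {..<t}) + of_bool (t \<in> E)" if "x > t" "x < t + d" for x
  proof -
    have "c = t" if "c \<in> E" "t \<le> c" "c < x" for c
      using d(2)[of c] that \<open>x < t + d\<close> by (force simp: dist_real_def)
    then have "E \<inter> {..<x} = E \<inter> {..<t} \<union> E \<inter> {t}"
      using that by force
    then show ?thesis
      using assms by (simp add: card_Un_disjoint Int_insert_right)
  qed
  then show "\<forall>\<^sub>F x in at_right t. card (E \<inter> {..<x}) = card (E \<inter> {..<t}) + of_bool (t \<in> E)"
    using d(1) by (intro eventually_at_rightI[of _ "t + d"]) auto
qed

text \<open>\<open>N\<close> may deviate at isolated points, so it is replaced by its
  punctured-limit value \<open>Q\<close>. This is locally constant on the connected half-line, hence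
  the same at both ends.\<close>

lemma eventually_const_connected:
  fixes N :: "real \<Rightarrow> bool"
  assumes loc: "\<And>t. t > 0 \<Longrightarrow> \<exists>q. \<forall>\<^sub>F x in at t. N x = q"
    and zero: "\<forall>\<^sub>F x in at_right 0. N x" and top: "\<forall>\<^sub>F x in at_top. N x = b"
  shows b
proof -
  define Q where "Q t \<longleftrightarrow> (\<forall>\<^sub>F x in at t. N x)" for t
  have Q: "\<forall>\<^sub>F x in at t. N x = Q t" if t: "t > 0" for t
  proof -
    obtain q where q: "\<forall>\<^sub>F x in at t. N x = q"
      using loc[OF t] by blast
    have "Q t = q"
      using q eventually_happens'[OF trivial_limit_at[of t]] eventually_conj[of N "at t" "\<lambda>x. N x = q"]
      by (cases q) (fastforce simp: Q_def)+
    then show ?thesis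
      using q by simp
  qed
  have Q_eq: "Q t = q" if "t \<in> U" "open U" "U \<subseteq> {0<..}" "\<And>x. x \<in> U \<Longrightarrow> N x = q" for t q U
  proof -
    have "\<forall>\<^sub>F x in at t. N x = q"
      using that unfolding eventually_at_topological by blast
    moreover have "\<forall>\<^sub>F x in at t. N x = Q t"
      using that by (intro Q) auto
    ultimately have "\<forall>\<^sub>F x in at t. Q t = q"
      by eventually_elim simp
    then show ?thesis
      by simp
  qed
  have const: "Q s = Q t" if "s > 0" "t > 0" for s t
  proof (rule connected_local_const[of "{0<..}"])
    show "\<forall>a\<in>{0<..}. \<forall>\<^sub>F b in at a within {0<..}. Q a = Q b"
    proof
      fix a :: real assume "a \<in> {0<..}"
      then obtain U where U: "open U" "a \<in> U" "\<And>x. x \<in> U \<Longrightarrow> x \<noteq> a \<Longrightarrow> N x = Q a"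
        using Q[of a] unfolding eventually_at_topological by auto
      have "Q a = Q x" if x: "x \<in> U" "x \<noteq> a" "x > 0" for x
      proof (rule sym, rule Q_eq)
        show "x \<in> (U - {a}) \<inter> {0<..}" "open ((U - {a}) \<inter> {0<..})" "(U - {a}) \<inter> {0<..} \<subseteq> {0<..}"
          using U(1) x by auto
        show "N z = Q a" if "z \<in> (U - {a}) \<inter> {0<..}" for z
          by (rule U(3)) (use that in auto)
      qed
      then show "\<forall>\<^sub>F b in at a within {0<..}. Q a = Q b"
        using U(1,2) unfolding eventually_at_topological by (intro exI[of _ U]) auto
    qed
  qed (use that in auto)
  obtain d where d: "d > 0" "\<And>x. 0 < x \<Longrightarrow> x < d \<Longrightarrow> N x"
    using zero unfolding eventually_at_right_field by auto
  obtain K where K: "\<And>x. K < x \<Longrightarrow> N x = b"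
    using top unfolding eventually_at_top_dense by auto
  have "Q (d / 2) = True"
    using d by (intro Q_eq[of _ "{0<..<d}"]) auto
  moreover have "Q (max K 0 + 1) = b"
    using K by (intro Q_eq[of _ "{max K 0<..}"]) auto
  moreover have "Q (d / 2) = Q (max K 0 + 1)"
    using d by (intro const) auto
  ultimately show b
    by simp
qed

context generic_pencil begin

definition aligned_for :: "real^'n^'n \<Rightarrow> real set" where
  "aligned_for S = {c. 0 < c \<and> (\<exists>v. aligned_trio A c S v)}"

lemma aligned_trioD:
  assumes "aligned_trio A c S v"
  shows "0 \<le> c" and "S \<in> sign_matrices"
  using assms by (auto simp: aligned_trio_def)

lemma aligned_trio_singular: "aligned_trio A c S v \<Longrightarrow> poly (pencil_det S) c = 0"
  unfolding aligned_trio_iff using singular_kernel_trivial by fastforce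

lemma finite_aligned_for: "S \<in> sign_matrices \<Longrightarrow> finite (aligned_for S)"
  by (rule finite_subset[OF _ poly_roots_finite[OF pencil_det_nonzero]])
     (auto simp: aligned_for_def aligned_trio_singular)

lemma aligned_for_iff:
  assumes "t > 0" "S \<in> sign_matrices"
  shows "t \<in> aligned_for S \<longleftrightarrow> (\<exists>v. (\<forall>i. 0 \<le> v $ i) \<and> v \<noteq> 0 \<and> pencil A S t *v v = 0)"
proof
  assume "t \<in> aligned_for S"
  then show "\<exists>v. (\<forall>i. 0 \<le> v $ i) \<and> v \<noteq> 0 \<and> pencil A S t *v v = 0"
    unfolding aligned_for_def aligned_trio_iff by force
next
  assume "\<exists>v. (\<forall>i. 0 \<le> v $ i) \<and> v \<noteq> 0 \<and> pencil A S t *v v = 0"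
  then show "t \<in> aligned_for S"
    using nonneg_kernel_positive(1)[of t S] assms unfolding aligned_for_def by auto
qed

text \<open>Positivity toggles at each positive aligned value of \<open>S\<close>; adding the number
  of those already passed compensates modulo 2.\<close>

definition corrected :: "real^'n^'n \<Rightarrow> real \<Rightarrow> nat" where
  "corrected S x = of_bool (positive S x) + card (aligned_for S \<inter> {..<x})"

lemma corrected_constant:
  assumes t: "t > 0" and S: "S \<in> sign_matrices"
    and nowall: "\<not> (poly (pencil_det S) t \<noteq> 0 \<and> (\<exists>i. solution S t $ i = 0))"
  shows "\<exists>q. \<forall>\<^sub>F x in at t. even (corrected S x) = q"
proof -
  let ?a = "t \<in> aligned_for S"
  \<comment> \<open>The inequality of truth values is an exclusive or: positivity toggles across
    \<open>t\<close> exactly if \<open>t\<close> is aligned for \<open>S\<close>.\<close>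
  have "\<exists>q. (\<forall>\<^sub>F x in at_left t. positive S x = q) \<and>
    (\<forall>\<^sub>F x in at_right t. positive S x = (q \<noteq> ?a))"
  proof (cases ?a)
    case True
    then show ?thesis
      using aligned_jump[of t S] aligned_for_iff[OF t S] t S by fastforce
  next
    case False
    have "\<exists>q. \<forall>\<^sub>F x in at t. positive S x = q"
    proof (cases "poly (pencil_det S) t = 0")
      case True
      have "\<forall>\<^sub>F x in at t. \<not> positive S x"
        using False aligned_for_iff[OF t S] rhs_outside_range[OF S, of t] True
        by (intro eventually_not_positive[OF S]) (auto simp: poly_pencil_det)
      then show ?thesis
        by (intro exI[of _ False]) simp
    next
      case False
      then show ?thesis
        using regular_constant[OF S] nowall by blast
    qed
    then show ?thesis
      using False by (simp add: eventually_at_split)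
  qed
  then obtain q where q: "\<forall>\<^sub>F x in at_left t. positive S x = q"
    "\<forall>\<^sub>F x in at_right t. positive S x = (q \<noteq> ?a)"
    by blast
  let ?r = "even (of_bool q + card (aligned_for S \<inter> {..<t}))"
  have "\<forall>\<^sub>F x in at_left t. even (corrected S x) = ?r"
    using q(1) card_below_jump(1)[OF finite_aligned_for[OF S], of t]
    by eventually_elim (simp add: corrected_def)
  moreover have "\<forall>\<^sub>F x in at_right t. even (corrected S x) = ?r"
    using q(2) card_below_jump(2)[OF finite_aligned_for[OF S], of t]
    by eventually_elim (auto simp: corrected_def)
  ultimately show ?thesis
    by (auto simp: eventually_at_split)
qed

text \<open>At a wall, where one coordinate of the solution vanishes, the two sign matrices that differ in
  that coordinate share the solution and its Cramer numerator; only their joint count keeps its parity.\<close>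

lemma sum_corrected_constant:
  assumes t: "t > 0"
  shows "\<exists>q. \<forall>\<^sub>F x in at t. even (\<Sum>S\<in>sign_matrices. corrected S x) = q"
proof -
  define B where "B = {S \<in> sign_matrices. poly (pencil_det S) t \<noteq> 0 \<and> (\<exists>i. solution S t $ i = 0)}"
  have finB: "finite B"
    unfolding B_def using finite_sign_matrices by auto
  \<comment> \<open>The choice depends only on the solution vector, which \<open>S\<close> and its
    flip share; so both choose the same index and \<open>g\<close> is an involution.\<close>
  define z where "z S = (SOME i. solution S t $ i = 0)" for S
  have z: "solution S t $ z S = 0" if "S \<in> B" for S
    using that unfolding B_def z_def by (auto intro: someI)
  define g where "g S = flip (z S) S" for S
  have g: "g S \<in> B" "z (g S) = z S" if "S \<in> B" for S
    using that wall_flip[of S t "z S"] z[OF that] by (auto simp: B_def g_def z_def)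
  have "\<exists>q. \<forall>\<^sub>F x in at t. even (\<Sum>S\<in>B. corrected S x) = q"
  proof -
    have "(\<Sum>S\<in>B. corrected S x) =
        (\<Sum>S\<in>{S \<in> B. S $ z S $ z S = 1}. corrected S x + corrected (g S) x)" for x
    proof (rule sum_involution[OF finB])
      fix S assume S: "S \<in> B"
      then have "g (g S) = S"
        using g(2)[OF S] by (simp add: g_def[of "g S"]) (simp add: g_def)
      then show "g S \<in> B \<and> g (g S) = S \<and> (g S $ z (g S) $ z (g S) = 1 \<longleftrightarrow> S $ z S $ z S \<noteq> 1)"
        using S g[OF S] flip_diag_sign[of S "z S"] by (simp add: B_def) (simp add: g_def)
    qed
    moreover have "\<exists>q. \<forall>\<^sub>F x in at t. even (corrected S x + corrected (g S) x) = q" if S: "S \<in> B" for S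
    proof -
      have card: "\<forall>\<^sub>F x in at t. card (aligned_for T \<inter> {..<x}) = card (aligned_for T \<inter> {..<t})"
        if "T \<in> B" for T
      proof -
        \<comment> \<open>Pencils in \<open>B\<close> are nonsingular at \<open>t\<close>, so no
          correction term jumps there.\<close>
        have "t \<notin> aligned_for T"
          using that aligned_trio_singular by (auto simp: B_def aligned_for_def)
        then show ?thesis
          using card_below_jump[OF finite_aligned_for, of T t] that
          by (auto simp: eventually_at_split B_def)
      qed
      obtain q where "\<forall>\<^sub>F x in at t. (positive S x \<longleftrightarrow> positive (g S) x) = q"
        using wall_constant[of S t "z S"] cramer_numerator_nonzero z[OF S] S
        by (auto simp: B_def g_def)
      then have "\<forall>\<^sub>F x in at t. even (corrected S x + corrected (g S) x) =
          (q = even (card (aligned_for S \<inter> {..<t}) + card (aligned_for (g S) \<inter> {..<t})))"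
        using card[OF S] card[OF g(1)[OF S]]
        by eventually_elim (auto simp: corrected_def)
      then show ?thesis
        by blast
    qed
    ultimately show ?thesis
      using finB by (simp only:) (intro eventually_even_sum, auto)
  qed
  moreover have "\<exists>q. \<forall>\<^sub>F x in at t. even (\<Sum>S\<in>sign_matrices - B. corrected S x) = q"
    by (rule eventually_even_sum)
       (use finite_sign_matrices corrected_constant[OF t] in \<open>auto simp: B_def\<close>)
  ultimately obtain q r where "\<forall>\<^sub>F x in at t. even (\<Sum>S\<in>B. corrected S x) = q"
    "\<forall>\<^sub>F x in at t. even (\<Sum>S\<in>sign_matrices - B. corrected S x) = r"
    by blast
  then have "\<forall>\<^sub>F x in at t. even (\<Sum>S\<in>sign_matrices. corrected S x) = (q = r)"
  proof eventually_elim
    case (elim x)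
    have "(\<Sum>S\<in>sign_matrices. corrected S x) =
        (\<Sum>S\<in>sign_matrices - B. corrected S x) + (\<Sum>S\<in>B. corrected S x)"
      by (rule sum.subset_diff) (auto simp: B_def finite_sign_matrices)
    then show ?case
      using elim by auto
  qed
  then show ?thesis
    by blast
qed

lemma odd_card_positive_aligned:
  assumes "CARD('n) = 1 \<Longrightarrow> A \<noteq> 0"
  shows "odd (\<Sum>S\<in>sign_matrices. card (aligned_for S))"
proof -
  define m where "m = (\<Sum>S\<in>sign_matrices. card (aligned_for S))"
  have split: "(\<Sum>S\<in>sign_matrices. corrected S x) = card {S \<in> sign_matrices. positive S x} +
      (\<Sum>S\<in>sign_matrices. card (aligned_for S \<inter> {..<x}))" for x
    by (simp add: corrected_def sum.distrib card_eq_sum_of_bool[OF finite_sign_matrices])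
  have zero: "\<forall>\<^sub>F x in at_right 0. even (card {S \<in> sign_matrices. positive S x})"
    by (rule even_card_positive_at_zero) (rule assms)
  \<comment> \<open>For large \<open>x\<close> the corrected sum is \<open>m\<close> plus the single
    positive solution; near 0 it is even.\<close>
  have "even (Suc m)"
  proof (rule eventually_const_connected)
    show "\<exists>q. \<forall>\<^sub>F x in at t. even (\<Sum>S\<in>sign_matrices. corrected S x) = q" if "t > 0" for t
      using sum_corrected_constant[OF that] .
    have "\<forall>\<^sub>F x in at_right 0. card (aligned_for S \<inter> {..<x}) = 0" if S: "S \<in> sign_matrices" for S
    proof -
      have "aligned_for S \<inter> {..<0} = {}" "0 \<notin> aligned_for S"
        by (auto simp: aligned_for_def)
      then show ?thesis
        using card_below_jump(2)[OF finite_aligned_for[OF S], of 0] by simp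
    qed
    then have "\<forall>\<^sub>F x in at_right 0. \<forall>S\<in>sign_matrices. card (aligned_for S \<inter> {..<x}) = 0"
      by (simp add: eventually_ball_finite finite_sign_matrices)
    then show "\<forall>\<^sub>F x in at_right 0. even (\<Sum>S\<in>sign_matrices. corrected S x)"
      using zero by eventually_elim (simp add: split)
    have "\<forall>\<^sub>F x in at_top. card (aligned_for S \<inter> {..<x}) = card (aligned_for S)"
      if S: "S \<in> sign_matrices" for S
    proof -
      have "\<forall>\<^sub>F x in at_top. \<forall>c\<in>aligned_for S. c < x"
        using finite_aligned_for[OF S] by (intro eventually_ball_finite) (auto intro: eventually_gt_at_top)
      then show ?thesis
        by eventually_elim (metis Int_absorb2 lessThan_iff subsetI)
    qed
    then have "\<forall>\<^sub>F x in at_top. \<forall>S\<in>sign_matrices. card (aligned_for S \<inter> {..<x}) = card (aligned_for S)"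
      by (simp add: eventually_ball_finite finite_sign_matrices)
    then show "\<forall>\<^sub>F x in at_top. even (\<Sum>S\<in>sign_matrices. corrected S x) = even (Suc m)"
      using card_positive_at_top
      by eventually_elim (simp add: split m_def)
  qed
  then show ?thesis
    by (simp add: m_def)
qed

section \<open>From sign matrices to multiplicities\<close>

lemma aligned_vector_unique:
  assumes "aligned_trio A c S u" "aligned_trio A c S v"
  shows "u = v"
proof -
  have uv: "\<forall>i. 0 \<le> u $ i" "\<forall>i. 0 \<le> v $ i" "norm u = 1" "norm v = 1" "c \<ge> 0" "S \<in> sign_matrices"
    "pencil A S c *v u = 0" "pencil A S c *v v = 0"
    using assms by (auto simp: aligned_trio_iff)
  then have "v \<noteq> 0"
    by auto
  then obtain k where k: "u = k *\<^sub>R v"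
    using nonneg_kernel_unique uv by blast
  then have "\<bar>k\<bar> = 1"
    using uv by simp
  \<comment> \<open>Comparing one coordinate of the positive \<open>v\<close> with the nonnegative
    \<open>u\<close> rules out \<open>k = -1\<close>.\<close>
  moreover have "0 < v $ undefined" "0 \<le> k * v $ undefined"
    using nonneg_kernel_positive(2)[OF uv(5,6,2) \<open>v \<noteq> 0\<close> uv(8)] uv(1) k by auto
  then have "0 \<le> k"
    by (simp add: zero_le_mult_iff)
  ultimately show ?thesis
    using k by simp
qed

text \<open>The vector is determined by \<open>c\<close> and \<open>S\<close>, so counting pairs
  amounts to counting sign matrices.\<close>

lemma aligned_multiplicity_eq:
  "aligned_multiplicity A c = card {S \<in> sign_matrices. \<exists>v. aligned_trio A c S v}"
proof -
  have "bij_betw fst {(S, v). aligned_trio A c S v} {S \<in> sign_matrices. \<exists>v. aligned_trio A c S v}"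
    unfolding bij_betw_def inj_on_def
    using aligned_trioD(2) by (fastforce dest: aligned_vector_unique simp: image_iff)
  then show ?thesis
    by (simp add: aligned_multiplicity_def bij_betw_same_card)
qed

lemma aligned_at_zero:
  assumes "aligned_trio A 0 S v" "T \<in> sign_matrices"
  shows "aligned_trio A 0 T v"
  using assms by (simp add: aligned_trio_iff pencil_mult)

lemma even_aligned_multiplicity_zero: "even (aligned_multiplicity A 0)"
proof (cases "\<exists>S v. aligned_trio A 0 S v")
  case True
  then have "{S \<in> sign_matrices. \<exists>v. aligned_trio A 0 S v} = sign_matrices"
    using aligned_at_zero by blast
  then show ?thesis
    by (simp add: aligned_multiplicity_eq even_card_sign_matrices)
next
  case False
  then show ?thesis
    by (simp add: aligned_multiplicity_eq)
qed

lemma finite_aligned_values: "finite (aligned_values A)"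
proof -
  have "aligned_values A \<subseteq> (\<Union>S\<in>sign_matrices. {x. poly (pencil_det S) x = 0})"
    using aligned_trio_singular by (fastforce simp: aligned_values_def aligned_trio_def)
  then show ?thesis
    by (rule finite_subset) (auto simp: finite_sign_matrices poly_roots_finite pencil_det_nonzero)
qed

lemma odd_sum_aligned_multiplicity:
  assumes "CARD('n) = 1 \<Longrightarrow> A \<noteq> 0"
  shows "odd (\<Sum>c\<in>aligned_values A. aligned_multiplicity A c)"
proof -
  let ?P = "aligned_values A - {0}"
  have odd: "odd (\<Sum>S\<in>sign_matrices. card (aligned_for S))"
    by (rule odd_card_positive_aligned) (rule assms)
  have "(\<Sum>c\<in>?P. aligned_multiplicity A c) =
      (\<Sum>c\<in>?P. \<Sum>S\<in>sign_matrices. of_bool (\<exists>v. aligned_trio A c S v))"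
    by (simp only: aligned_multiplicity_eq card_eq_sum_of_bool[OF finite_sign_matrices])
  \<comment> \<open>Double counting of the incidences between positive aligned values and sign
    matrices.\<close>
  also have "\<dots> = (\<Sum>S\<in>sign_matrices. \<Sum>c\<in>?P. of_bool (\<exists>v. aligned_trio A c S v))"
    by (rule sum.swap)
  also have "\<dots> = (\<Sum>S\<in>sign_matrices. card {c \<in> ?P. \<exists>v. aligned_trio A c S v})"
    using finite_aligned_values by (simp only: card_eq_sum_of_bool finite_Diff)
  also have "\<dots> = (\<Sum>S\<in>sign_matrices. card (aligned_for S))"
  proof -
    have "{c \<in> ?P. \<exists>v. aligned_trio A c S v} = aligned_for S" for S
      using aligned_trioD(1)[of _ S] by (fastforce simp: aligned_for_def aligned_values_def less_le)
    then show ?thesis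
      by simp
  qed
  finally have "odd (\<Sum>c\<in>?P. aligned_multiplicity A c)"
    using odd by simp
  moreover have "even (\<Sum>c\<in>aligned_values A \<inter> {0}. aligned_multiplicity A c)"
    by (rule dvd_sum) (simp add: even_aligned_multiplicity_zero)
  ultimately show ?thesis
    by (simp add: sum.Int_Diff[OF finite_aligned_values, of _ "{0}"])
qed

end

section \<open>Existence of a generic right-hand side\<close>

text \<open>The map below reads the spectral parameter off the \<open>i\<close>-th coordinate, which is free
  because it vanishes in the solution; so the bad right-hand sides are the image of a hyperplane
  under a polynomial map.\<close>

lemma negligible_two_zeros:
  fixes A :: "real^'n^'n"
  assumes "i \<noteq> j"
  shows "negligible {y. \<exists>x v. pencil A S x *v v = y \<and> v $ i = 0 \<and> v $ j = 0}"
proof -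
  define f where "f u = (u $ i) *\<^sub>R (S *v (u - (u $ i) *\<^sub>R axis i 1)) - A *v (u - (u $ i) *\<^sub>R axis i 1)"
    for u :: "real^'n"
  have "(\<lambda>u::real^'n. u $ i) differentiable at u" for u
    by (rule bounded_linear_imp_differentiable[OF bounded_linear_vec_nth])
  then have "f differentiable_on {u. u $ j = 0}"
    unfolding f_def differentiable_on_def
    by (auto intro!: differentiable_diff differentiable_scaleR differentiable_const differentiable_ident
        differentiable_compose[OF linear_imp_differentiable[OF matrix_vector_mul_linear]]
        intro: differentiable_at_withinI)
  then have neg: "negligible (f ` {u. u $ j = 0})"
    by (rule negligible_differentiable_image_negligible[OF order_refl negligible_standard_hyperplane_cart])
  have "{y. \<exists>x v. pencil A S x *v v = y \<and> v $ i = 0 \<and> v $ j = 0} \<subseteq> f ` {u. u $ j = 0}"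
  proof clarify
    fix x and v :: "real^'n" assume v: "v $ i = 0" "v $ j = 0"
    define u where "u = v + x *\<^sub>R axis i 1"
    have "u $ i = x" "u $ j = 0"
      using v assms by (simp_all add: u_def axis_def)
    then have "f u = pencil A S x *v v" "u \<in> {u. u $ j = 0}"
      by (simp_all add: f_def pencil_mult u_def)
    then show "pencil A S x *v v \<in> f ` {u. u $ j = 0}"
      by (metis image_eqI)
  qed
  with neg show ?thesis
    by (rule negligible_subset)
qed

text \<open>The conditions on \<open>y\<close> fail only on a finite union of negligible sets, which
  cannot fill the space.\<close>

lemma generic_rhs_exists:
  fixes A :: "real^'n^'n"
  assumes "generic_matrix A"
  shows "\<exists>y. generic_pencil A y"
proof -
  define N1 where "N1 = (\<Union>i. {y :: real^'n. y $ i = 0})"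
  \<comment> \<open>A finite union of proper subspaces, since each pencil is singular at finitely
    many \<open>x\<close> only.\<close>
  define N2 where "N2 = (\<Union>S\<in>sign_matrices. \<Union>x\<in>{x. det (pencil A S x) = 0}. range ((*v) (pencil A S x)))"
  \<comment> \<open>Here \<open>x\<close> ranges over a continuum, so the union over
    \<open>x\<close> is handled inside \<open>negligible_two_zeros\<close>.\<close>
  define N3 where "N3 = (\<Union>S\<in>sign_matrices. \<Union>(i, j)\<in>{(i, j). i \<noteq> j}.
      {y. \<exists>x v. pencil A S x *v v = y \<and> v $ i = 0 \<and> v $ j = 0})"
  define N4 where "N4 = (\<Union>i. (*v) A ` {v. v $ i = 0})"
  have "negligible N1"
    unfolding N1_def by (intro negligible_Union) (auto simp: negligible_standard_hyperplane_cart)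
  moreover have "negligible N2"
  proof -
    have "negligible (range ((*v) (pencil A S x)))" if "det (pencil A S x) = 0" for S x
      using that by (intro negligible_linear_singular_image matrix_vector_mul_linear)
        (simp add: det_nz_iff_inj[symmetric])
    then show ?thesis
      unfolding N2_def using finite_singular_pencil finite_sign_matrices
      by (intro negligible_Union finite_imageI ballI) (auto intro!: negligible_Union finite_imageI)
  qed
  moreover have "negligible N3"
    unfolding N3_def using finite_sign_matrices
    by (auto intro!: negligible_Union negligible_two_zeros)
  moreover have "negligible N4"
  proof -
    have "negligible ((*v) A ` {v. v $ i = 0})" for i
      by (rule negligible_differentiable_image_negligible[OF order_refl
            negligible_standard_hyperplane_cart])
         (simp add: linear_imp_differentiable_on)
    then show ?thesis
      unfolding N4_def by (intro negligible_Union) auto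
  qed
  ultimately have "negligible (N1 \<union> N2 \<union> N3 \<union> N4)"
    by simp
  then obtain y where y: "y \<notin> N1 \<union> N2 \<union> N3 \<union> N4"
    using non_negligible_UNIV by (metis UNIV_eq_I)
  have "generic_pencil A y"
  proof
    show "generic_matrix A"
      by fact
    show "y $ i \<noteq> 0" for i
      using y by (auto simp: N1_def)
    show "pencil A S x *v v \<noteq> y" if "S \<in> sign_matrices" "det (pencil A S x) = 0" for S x v
      using y that by (auto simp: N2_def)
    show "i = j" if "S \<in> sign_matrices" "pencil A S x *v v = y" "v $ i = 0" "v $ j = 0" for S x v i j
      using y that by (fastforce simp: N3_def)
    show "v $ i \<noteq> 0" if "A *v v = y" for v i
      using y that by (auto simp: N4_def)
  qed
  then show ?thesis
    by blast
qed

theorem corollary1p2: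
  fixes A :: "real^'n^'n"
  assumes "generic_matrix A"
    and "CARD('n) = 1 \<Longrightarrow> A \<noteq> 0"
  shows "odd (\<Sum>c\<in>aligned_values A. aligned_multiplicity A c)"
proof -
  obtain y where "generic_pencil A y"
    using generic_rhs_exists[OF assms(1)] by blast
  then show ?thesis
    using generic_pencil.odd_sum_aligned_multiplicity assms(2) by blast
qed

end
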